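(* Let $a,b\in\mathbb{R}$, $\alpha\in[0,1]$ and $\mu,\nu\in\mathbb{R}$. Then the left and right iterated AB fractional difference operators each have the semigroup property in $\mu$. Namely, for every function $f$ defined on $\mathbb{N}_a$ and every $t\in\mathbb{N}_a$, $${}^{AB}_{\;\;a}\nabla^{(-\alpha,\mu)}\,{}^{AB}_{\;\;a}\nabla^{(-\alpha,\nu)}f(t)={}^{AB}_{\;\;a}\nabla^{(-\alpha,\mu+\nu)}f(t),$$ and for every function $f$ defined on ${}_b\mathbb{N}$ and every $t\in{}_b\mathbb{N}$, $${}^{AB}\nabla_b^{(-\alpha,\mu)}\,{}^{AB}\nabla_b^{(-\alpha,\nu)}f(t)={}^{AB}\nabla_b^{(-\alpha,\mu+\nu)}f(t).$$
   Context: Notation: $\mathbb{N}_a=\{a,a+1,a+2,\dots\}$, ${}_b\mathbb{N}=\{b,b-1,b-2,\dots\}$, $\rho(s)=s-1$, $\nabla g(t)=g(t)-g(t-1)$, $\Delta g(t)=g(t+1)-g(t)$. The rising function is $x^{\overline{\gamma}}=\Gamma(x+\gamma)/\Gamma(x)$ for $x\in\mathbb{R}\setminus\{\dots,-2,-1,0\}$, and $0^{\overline{\gamma}}=0$. Nabla fractional sums of order $\gamma>0$ (empty sums, i.e. $t\le a$, respectively $t\ge b$, are $0$): the left one is ${}_a\nabla^{-\gamma}f(t)=\frac{1}{\Gamma(\gamma)}\sum_{s=a+1}^{t}(t-\rho(s))^{\overline{\gamma-1}}f(s)$; the right one is $\nabla_b^{-\gamma}f(t)=\frac{1}{\Gamma(\gamma)}\sum_{s=t}^{b-1}(s-\rho(t))^{\overline{\gamma-1}}f(s)$.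 Also ${}_a\nabla^{-0}f=f$ and $\nabla_b^{-0}f=f$. $B(\alpha)$ is the (positive) normalisation function of Atangana--Baleanu (AB) calculus, with $B(0)=B(1)=1$. Iterated left and right AB fractional difference-sums of order $(-\alpha,\mu)$, for $\alpha\in[0,1]$, $\mu\in\mathbb{R}$, and $f$ defined on $\mathbb{N}_a$, respectively on ${}_b\mathbb{N}$: $${}^{AB}_{\;\;a}\nabla^{(-\alpha,\mu)}f(t)=\sum_{k=0}^{\infty}\frac{\binom{\mu}{k}(1-\alpha)^{\mu-k}\alpha^k}{B(\alpha)^{\mu}}\;{}_a\nabla^{-k\alpha}f(t),\qquad {}^{AB}\nabla_b^{(-\alpha,\mu)}f(t)=\sum_{k=0}^{\infty}\frac{\binom{\mu}{k}(1-\alpha)^{\mu-k}\alpha^k}{B(\alpha)^{\mu}}\;\nabla_b^{-k\alpha}f(t),$$ where $\binom{\mu}{k}=\mu(\mu-1)\cdots(\mu-k+1)/k!$ and $0^0=1$. In the limiting case $\alpha\to1$ the convention is ${}^{AB}_{\;\;a}\nabla^{(-1,\mu)}f={}_a\nabla^{-\mu}f$ and ${}^{AB}_{\;\;a}\nabla^{(-1,-\mu)}f={}_a\nabla^{\mu}f$ for $\mu>0$, where ${}_a\nabla^{\mu}=\nabla^{n}\,{}_a\nabla^{-(n-\mu)}$ with $n=\lfloor\mu\rfloor+1$ is the nabla fractional difference, and correspondingly on the right with $\nabla_b^{\mu}=(-\Delta)^{n}\,\nabla_b^{-(n-\mu)}$.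
   Formalization: For 1/2 ≤ α < 1 the series can diverge, so convergence of the ν-series at domain points from the endpoint to t, and of the outer μ-series and the (μ+ν)-series at t, is assumed; for α=1, μ+ν=0, μ≠0 the endpoint t=a (resp. t=b) is excluded, where the identity fails unless f vanishes there. *)

theory Defs
  imports "HOL-Analysis.Analysis"
begin

definition nats_from :: "real \<Rightarrow> real set" where
  "nats_from a = {a + real n | n. True}"

definition nats_to :: "real \<Rightarrow> real set" where
  "nats_to b = {b - real n | n. True}"

definition backward_diff :: "(real \<Rightarrow> real) \<Rightarrow> real \<Rightarrow> real" where
  "backward_diff g t = g t - g (t - 1)"

definition forward_diff :: "(real \<Rightarrow> real) \<Rightarrow> real \<Rightarrow> real" where
  "forward_diff g t = g (t + 1) - g t"

definition rising :: "real \<Rightarrow> real \<Rightarrow> real" where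
  "rising x \<gamma> = (if x = 0 then 0 else Gamma (x + \<gamma>) / Gamma x)"

text \<open>
  Functions on \<open>nats_from a\<close> and \<open>nats_to b\<close> are represented by total functions on the reals.
  At points of \<open>nats_from a\<close> (respectively \<open>nats_to b\<close>) none of the operators below depends on
  the values of \<open>f\<close> outside that set. The fractional sums of positive order vanish for
  \<open>t \<le> a\<close> (respectively \<open>t \<ge> b\<close>), where the range of summation is empty.
\<close>

definition nabla_sum_left :: "real \<Rightarrow> real \<Rightarrow> (real \<Rightarrow> real) \<Rightarrow> real \<Rightarrow> real" where
  "nabla_sum_left a \<gamma> f t =
    (if \<gamma> = 0 then f t
     else 1 / Gamma \<gamma> *
       (\<Sum>s\<in>{s \<in> nats_from (a + 1). s \<le> t}. rising (t - (s - 1)) (\<gamma> - 1) * f s))"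

definition nabla_sum_right :: "real \<Rightarrow> real \<Rightarrow> (real \<Rightarrow> real) \<Rightarrow> real \<Rightarrow> real" where
  "nabla_sum_right b \<gamma> f t =
    (if \<gamma> = 0 then f t
     else 1 / Gamma \<gamma> *
       (\<Sum>s\<in>{s \<in> nats_to (b - 1). t \<le> s}. rising (s - (t - 1)) (\<gamma> - 1) * f s))"

text \<open>
  Fractional differences of order \<open>\<mu> > 0\<close>. As \<open>n - \<mu>\<close> lies in \<open>(0, 1]\<close>, the inner sum is zero
  beyond the endpoint, so that the \<open>n\<close>-fold difference is meaningful near and at the endpoint.
\<close>

definition nabla_diff_left :: "real \<Rightarrow> real \<Rightarrow> (real \<Rightarrow> real) \<Rightarrow> real \<Rightarrow> real" where
  "nabla_diff_left a \<mu> f =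
    (let n = nat \<lfloor>\<mu>\<rfloor> + 1 in (backward_diff ^^ n) (nabla_sum_left a (real n - \<mu>) f))"

definition nabla_diff_right :: "real \<Rightarrow> real \<Rightarrow> (real \<Rightarrow> real) \<Rightarrow> real \<Rightarrow> real" where
  "nabla_diff_right b \<mu> f =
    (let n = nat \<lfloor>\<mu>\<rfloor> + 1 in
      ((\<lambda>g t. - forward_diff g t) ^^ n) (nabla_sum_right b (real n - \<mu>) f))"

text \<open>
  The coefficient is only used for \<open>\<alpha> < 1\<close>, where the bases of both real powers are positive.
\<close>

definition AB_coeff :: "(real \<Rightarrow> real) \<Rightarrow> real \<Rightarrow> real \<Rightarrow> nat \<Rightarrow> real" where
  "AB_coeff B \<alpha> \<mu> k =
    (\<mu> gchoose k) * (1 - \<alpha>) powr (\<mu> - real k) * \<alpha> ^ k / B \<alpha> powr \<mu>"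

text \<open>
  Convergence of the defining series at a point. For a divergent series \<open>suminf\<close> is an unspecified
  number, and the corresponding operator below has no meaning. For \<open>\<alpha> < 1 / 2\<close> the series
  converges absolutely. For \<open>1 / 2 \<le> \<alpha> < 1\<close> and \<open>\<mu>\<close> not a natural number it need not converge: at
  \<open>t = a + 1\<close> and at \<open>t = b - 1\<close> all fractional sums equal \<open>f t\<close>, and the series reduces to
  a multiple of the binomial series with ratio \<open>\<alpha> / (1 - \<alpha>) \<ge> 1\<close>.
\<close>

definition AB_left_converges ::
  "(real \<Rightarrow> real) \<Rightarrow> real \<Rightarrow> real \<Rightarrow> real \<Rightarrow> (real \<Rightarrow> real) \<Rightarrow> real \<Rightarrow> bool" where
  "AB_left_converges B a \<alpha> \<mu> f t \<longleftrightarrow>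
    summable (\<lambda>k. AB_coeff B \<alpha> \<mu> k * nabla_sum_left a (real k * \<alpha>) f t)"

definition AB_right_converges ::
  "(real \<Rightarrow> real) \<Rightarrow> real \<Rightarrow> real \<Rightarrow> real \<Rightarrow> (real \<Rightarrow> real) \<Rightarrow> real \<Rightarrow> bool" where
  "AB_right_converges B b \<alpha> \<mu> f t \<longleftrightarrow>
    summable (\<lambda>k. AB_coeff B \<alpha> \<mu> k * nabla_sum_right b (real k * \<alpha>) f t)"

text \<open>
  The operators of order \<open>(-\<alpha>, \<mu>)\<close>. For \<open>\<alpha> = 1\<close> they are fractional sums or differences by
  convention; order \<open>(-1, 0)\<close> is the identity, in accordance with \<open>0\<^sup>0 = 1\<close> in the series.
\<close>

definition AB_left ::
  "(real \<Rightarrow> real) \<Rightarrow> real \<Rightarrow> real \<Rightarrow> real \<Rightarrow> (real \<Rightarrow> real) \<Rightarrow> real \<Rightarrow> real" where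
  "AB_left B a \<alpha> \<mu> f t =
    (if \<alpha> = 1 then
       (if \<mu> > 0 then nabla_sum_left a \<mu> f t
        else if \<mu> < 0 then nabla_diff_left a (- \<mu>) f t
        else f t)
     else (\<Sum>k. AB_coeff B \<alpha> \<mu> k * nabla_sum_left a (real k * \<alpha>) f t))"

definition AB_right ::
  "(real \<Rightarrow> real) \<Rightarrow> real \<Rightarrow> real \<Rightarrow> real \<Rightarrow> (real \<Rightarrow> real) \<Rightarrow> real \<Rightarrow> real" where
  "AB_right B b \<alpha> \<mu> f t =
    (if \<alpha> = 1 then
       (if \<mu> > 0 then nabla_sum_right b \<mu> f t
        else if \<mu> < 0 then nabla_diff_right b (- \<mu>) f t
        else f t)
     else (\<Sum>k. AB_coeff B \<alpha> \<mu> k * nabla_sum_right b (real k * \<alpha>) f t))"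

end

theory Submission
  imports Defs "HOL-Complex_Analysis.Conformal_Mappings"
begin

text \<open>
  On the grid points \<open>a + 1, a + 2, \<dots>\<close> a function is encoded by a power series \<open>\<Phi>\<close> in an indeterminate \<open>X\<close>, and
  the nabla sum of order \<open>\<gamma>\<close> is multiplication of \<open>\<Phi>\<close> by \<open>(1 - X)\<^sup>-\<^sup>\<gamma>\<close>
  (\<open>nabla_sum_left_grid\<close>). The defining series of the operator of order \<open>(-\<alpha>, \<mu>)\<close> is therefore,
  formally, the binomial expansion of multiplication by \<open>B(\<alpha>)\<^sup>-\<^sup>\<mu> (1 - \<alpha> + \<alpha> (1 - X)\<^sup>-\<^sup>\<alpha>)\<^sup>\<mu>\<close>, and the semigroup property is the law of exponents for this kernel (\<open>AB_kernel_add\<close>). For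
  \<open>\<alpha> = 1\<close> the kernel is \<open>(1 - X)\<^sup>-\<^sup>\<mu>\<close>; for \<open>\<mu> < 0\<close> this is the fractional difference, because
  each backward difference multiplies by \<open>1 - X\<close>.

  The power of the kernel is made sense of by expanding about the constant term of the base, which
  is \<open>1\<close>: with \<open>N = (1 - X)\<^sup>-\<^sup>\<alpha> - 1\<close> the base is \<open>1 + \<alpha> N\<close>, and as \<open>N\<close> has no constant term, only
  finitely many powers of \<open>N\<close> contribute to each coefficient. The kernel thus exists for all
  \<open>\<alpha>\<close> and \<open>\<mu>\<close>. The analytic content is that the defining series, whose ratio is
  \<open>r = \<alpha> / (1 - \<alpha>)\<close>, takes the value predicted by the kernel whenever it converges
  (\<open>sums_binomial_transform\<close>). Its terms are \<open>(\<mu> gchoose k) P(k) r\<^sup>k\<close> with a polynomial \<open>P\<close>. If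
  \<open>r < 1\<close>, that is \<open>\<alpha> < 1/2\<close>, this is Newton's binomial series. If \<open>r \<ge> 1\<close>, convergence at \<open>r\<close> makes
  the power series analytic on the disc of radius \<open>r\<close>; there it continues to agree with the closed
  form to the right of \<open>-1\<close>, and Abel's limit theorem carries the identity to \<open>r\<close> itself. The
  three convergence hypotheses thus reduce the theorem to an identity of power series.

  At the endpoint \<open>a\<close> all sums of positive order vanish, so that the operator is multiplication by
  a number, which is treated by itself. The operators on the right are those on the left seen through
  \<open>t \<mapsto> -t\<close>.
\<close>

section \<open>Abel's limit theorem\<close>

text \<open>
  Summation by parts: the difference between the power series at \<open>x\<close> and \<open>s\<close> is \<open>1 - x\<close> times the
  power series of the errors of the partial sums. The errors tend to zero, so their power series
  is of smaller order than the geometric series \<open>1 / (1 - x)\<close> as \<open>x\<close> tends to \<open>1\<close>.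
\<close>

lemma Abel_limit:
  fixes c :: "nat \<Rightarrow> real"
  assumes "c sums s"
  shows "((\<lambda>x. \<Sum>k. c k * x ^ k) \<longlongrightarrow> s) (at_left 1)"
proof -
  define R where "R n = (\<Sum>k<n. c k) - s" for n
  have R0: "R \<longlonglongrightarrow> 0"
    using assms unfolding sums_def R_def by (simp add: LIM_zero)
  have "Bseq R" using R0 convergent_imp_Bseq convergentI by blast
  then obtain K where K: "\<And>n. \<bar>R n\<bar> \<le> K" "K > 0" unfolding Bseq_def by auto
  have sumR: "summable (\<lambda>n. R (Suc n) * x ^ n)" if "0 < x" "x < 1" for x :: real
    by (rule summable_comparison_test'[where g = "\<lambda>n. K * x ^ n" and N = 0])
       (use that K in \<open>auto simp: abs_mult intro!: mult_right_mono summable_mult summable_geometric\<close>)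
  have parts: "(\<lambda>k. c k * x ^ k) sums (s + (1 - x) * (\<Sum>n. R (Suc n) * x ^ n))"
    if x: "0 < x" "x < 1" for x
  proof -
    let ?S = "\<Sum>n. R (Suc n) * x ^ n"
    have "(\<lambda>n. R (Suc n) * x ^ n) sums ?S" using sumR[OF x] by (rule summable_sums)
    moreover have "(\<lambda>n. R n * x ^ n) sums (x * ?S - s)"
    proof -
      have "(\<lambda>n. x * (R (Suc n) * x ^ n)) sums (x * ?S)"
        using sumR[OF x] by (intro sums_mult summable_sums)
      then have "(\<lambda>n. R (Suc n) * x ^ Suc n) sums (x * ?S)" by (simp add: mult_ac)
      then show ?thesis by (subst (asm) sums_Suc_iff) (simp add: R_def)
    qed
    ultimately have "(\<lambda>n. R (Suc n) * x ^ n - R n * x ^ n) sums (?S - (x * ?S - s))"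
      by (rule sums_diff)
    moreover have "R (Suc n) * x ^ n - R n * x ^ n = c n * x ^ n" for n
      by (simp add: R_def algebra_simps)
    ultimately show ?thesis by (simp add: algebra_simps)
  qed
  \<comment> \<open>The first \<open>N\<close> errors contribute at most \<open>(1 - x) K N\<close>, the remaining ones at most \<open>e / 2\<close>.\<close>
  have "((\<lambda>x. (1 - x) * (\<Sum>n. R (Suc n) * x ^ n)) \<longlongrightarrow> 0) (at_left 1)"
  proof (rule tendstoI)
    fix e :: real assume "e > 0"
    have "eventually (\<lambda>n. \<bar>R (Suc n)\<bar> < e / 2) sequentially"
      using R0[THEN LIMSEQ_Suc, THEN tendstoD, of "e / 2"] \<open>e > 0\<close> by simp
    then obtain N where N: "\<And>n. n \<ge> N \<Longrightarrow> \<bar>R (Suc n)\<bar> < e / 2"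
      unfolding eventually_sequentially by blast
    have "((\<lambda>x::real. (1 - x) * (K * real N)) \<longlongrightarrow> (1 - 1) * (K * real N)) (at_left 1)"
      by (intro tendsto_intros)
    then have "eventually (\<lambda>x::real. (1 - x) * (K * real N) < e / 2) (at_left 1)"
      using \<open>e > 0\<close> by (auto dest!: order_tendstoD(2)[where a = "e / 2"])
    moreover have "eventually (\<lambda>x::real. x \<in> {0<..<1}) (at_left 1)"
      by (rule eventually_at_left_real) simp
    ultimately show "eventually (\<lambda>x. dist ((1 - x) * (\<Sum>n. R (Suc n) * x ^ n)) 0 < e) (at_left 1)"
    proof eventually_elim
      case (elim x)
      then have x: "0 < x" "x < 1" by auto
      have g: "(\<lambda>n. if n < N then K else 0) sums (K * real N)"
        using sums_If_finite_set[of "{..<N}" "\<lambda>_. K"] by (simp add: mult.commute)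
      have h: "(\<lambda>n. e / 2 * x ^ n) sums (e / 2 * (1 / (1 - x)))"
        using x by (intro sums_mult geometric_sums) auto
      have "\<bar>\<Sum>n. R (Suc n) * x ^ n\<bar> \<le> (\<Sum>n. (if n < N then K else 0) + e / 2 * x ^ n)"
      proof (rule order_trans[OF summable_rabs suminf_le])
        fix n
        show "\<bar>R (Suc n) * x ^ n\<bar> \<le> (if n < N then K else 0) + e / 2 * x ^ n"
        proof (cases "n < N")
          case True
          have "\<bar>R (Suc n)\<bar> * x ^ n \<le> K * 1"
            using K x by (intro mult_mono power_le_one) (auto intro: order.trans[OF _ K(1)])
          moreover have "0 \<le> e / 2 * x ^ n" using x \<open>e > 0\<close> by simp
          ultimately show ?thesis using True x by (simp add: abs_mult)
        next
          case False
          then show ?thesis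
            using N[of n] x by (auto simp: abs_mult intro!: mult_right_mono)
        qed
      next
        show "summable (\<lambda>n. \<bar>R (Suc n) * x ^ n\<bar>)"
          by (rule summable_comparison_test'[where g = "\<lambda>n. K * x ^ n" and N = 0])
             (use x K in \<open>auto simp: abs_mult intro!: mult_right_mono summable_mult summable_geometric\<close>)
        then show "summable (\<lambda>n. \<bar>R (Suc n) * x ^ n\<bar>)" .
      next
        show "summable (\<lambda>n. (if n < N then K else 0) + e / 2 * x ^ n)"
          using sums_add[OF g h] by (rule sums_summable)
      qed
      also have "\<dots> = K * real N + e / 2 * (1 / (1 - x))"
        using sums_add[OF g h] by (rule sums_unique[symmetric])
      finally have "(1 - x) * \<bar>\<Sum>n. R (Suc n) * x ^ n\<bar>
          \<le> (1 - x) * (K * real N + e / 2 * (1 / (1 - x)))"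
        using x by (intro mult_left_mono) auto
      also have "\<dots> = (1 - x) * (K * real N) + e / 2" using x by (simp add: field_simps)
      also have "\<dots> < e" using elim by simp
      finally show ?case using x by (simp add: abs_mult)
    qed
  qed
  then have "((\<lambda>x. s + (1 - x) * (\<Sum>n. R (Suc n) * x ^ n)) \<longlongrightarrow> s + 0) (at_left 1)"
    by (intro tendsto_intros)
  moreover have "eventually (\<lambda>x::real. x \<in> {0<..<1}) (at_left 1)"
    by (rule eventually_at_left_real) simp
  then have "eventually (\<lambda>x. s + (1 - x) * (\<Sum>n. R (Suc n) * x ^ n) = (\<Sum>k. c k * x ^ k)) (at_left 1)"
    by eventually_elim (use parts sums_unique in auto)
  ultimately show ?thesis
    by (auto intro: Lim_transform_eventually)
qed

section \<open>Binomial series weighted by polynomials\<close>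

text \<open>
  By trinomial revision the weight \<open>k choose j\<close> merely shifts the binomial series, replacing the
  exponent \<open>a\<close> by \<open>a - j\<close>.
\<close>

lemma sums_gbinomial_weighted:
  fixes a z :: complex
  assumes "norm z < 1"
  shows "(\<lambda>k. (a gchoose k) * of_nat (k choose j) * z ^ k) sums
           ((a gchoose j) * z ^ j * (1 + z) powr (a - of_nat j))"
proof -
  have "(\<lambda>i. (a gchoose j) * z ^ j * ((a - of_nat j gchoose i) * z ^ i)) sums
          ((a gchoose j) * z ^ j * (1 + z) powr (a - of_nat j))"
    by (intro sums_mult gen_binomial_complex assms)
  moreover have "(a gchoose j) * z ^ j * ((a - of_nat j gchoose i) * z ^ i) =
      (a gchoose (i + j)) * of_nat ((i + j) choose j) * z ^ (i + j)" for i
    using gbinomial_trinomial_revision[of j "i + j" a]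
    by (simp add: binomial_gbinomial power_add mult_ac)
  ultimately have "(\<lambda>i. (a gchoose (i + j)) * of_nat ((i + j) choose j) * z ^ (i + j)) sums
          ((a gchoose j) * z ^ j * (1 + z) powr (a - of_nat j))" by simp
  then show ?thesis by (subst (asm) sums_iff_shift) (simp add: binomial_eq_0)
qed

lemma gbinomial_of_real: "of_real (a gchoose k) = (of_real a gchoose k :: 'a::{real_field})"
  by (simp add: gbinomial_prod_rev)

text \<open>
  An arbitrary polynomial in \<open>k\<close> of degree at most \<open>n\<close>, written in Newton's basis \<open>k choose j\<close>.
\<close>

definition binomial_transform :: "(nat \<Rightarrow> real) \<Rightarrow> nat \<Rightarrow> nat \<Rightarrow> real" where
  "binomial_transform p n k = (\<Sum>j\<le>n. real (k choose j) * p j)"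

text \<open>
  The sum of the binomial series weighted by such a polynomial. It is stated over the complex numbers
  to make it available for analytic continuation.
\<close>

definition binomial_closed_form :: "real \<Rightarrow> (nat \<Rightarrow> real) \<Rightarrow> nat \<Rightarrow> complex \<Rightarrow> complex" where
  "binomial_closed_form \<mu> p n z =
     (\<Sum>j\<le>n. of_real (p j) * (of_real (\<mu> gchoose j) * z ^ j * (1 + z) powr (of_real \<mu> - of_nat j)))"

lemma sums_binomial_closed_form:
  assumes "norm z < 1"
  shows "(\<lambda>k. of_real ((\<mu> gchoose k) * binomial_transform p n k) * z ^ k)
           sums binomial_closed_form \<mu> p n z"
proof -
  have "(\<lambda>k. \<Sum>j\<le>n. of_real (p j) * ((of_real \<mu> gchoose k) * of_nat (k choose j) * z ^ k))
          sums binomial_closed_form \<mu> p n z"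
    unfolding binomial_closed_form_def gbinomial_of_real
    by (intro sums_sum sums_mult sums_gbinomial_weighted assms)
  then show ?thesis
    by (simp add: binomial_transform_def gbinomial_of_real sum_distrib_left sum_distrib_right mult_ac)
qed

lemma binomial_closed_form_of_real:
  assumes "0 \<le> x"
  shows "binomial_closed_form \<mu> p n (of_real x) =
     of_real ((1 + x) powr \<mu> * (\<Sum>j\<le>n. (\<mu> gchoose j) * (x / (1 + x)) ^ j * p j))"
proof -
  have "(1 + of_real x :: complex) powr (of_real \<mu> - of_nat j) =
      of_real ((1 + x) powr \<mu> / (1 + x) ^ j)" for j
    using assms powr_of_real[of "1 + x" "\<mu> - real j"] by (simp add: powr_diff powr_realpow)
  then show ?thesis
    by (simp add: binomial_closed_form_def sum_distrib_left power_divide mult_ac)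
qed

text \<open>
  Convergence at some \<open>r \<ge> 1\<close> restricts \<open>\<mu>\<close> and \<open>p\<close>. Instead of a study of the admissible parameters, the
  proof takes from it that the power series is analytic on the disc of radius \<open>r\<close>. The closed form is
  analytic in the half-plane to the right of \<open>-1\<close>, which avoids the branch cut of \<open>(1 + z) powr _\<close>. The
  part of the disc in this half-plane is convex, and it contains both the unit disc, where the two
  functions agree, and the interval from \<open>0\<close> to \<open>r\<close> without \<open>r\<close>, along which Abel's limit is taken.
\<close>

lemma sums_binomial_transform:
  assumes "0 \<le> r"
    and summ: "1 \<le> r \<Longrightarrow> summable (\<lambda>k. (\<mu> gchoose k) * binomial_transform p n k * r ^ k)"
  shows "(\<lambda>k. (\<mu> gchoose k) * binomial_transform p n k * r ^ k) sums
           ((1 + r) powr \<mu> * (\<Sum>j\<le>n. (\<mu> gchoose j) * (r / (1 + r)) ^ j * p j))"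
proof (cases "r < 1")
  case True
  then show ?thesis
    using sums_binomial_closed_form[of "of_real r" \<mu> p n] assms(1)
      binomial_closed_form_of_real[OF assms(1), of \<mu> p n]
    by (simp flip: of_real_mult of_real_power add: sums_of_real_iff)
next
  case False
  then have "1 \<le> r" by simp
  define c where "c k = (\<mu> gchoose k) * binomial_transform p n k" for k
  define C where "C = Abs_fps (\<lambda>k. of_real (c k) :: complex)"
  define E where "E = (\<lambda>x. (1 + x) powr \<mu> * (\<Sum>j\<le>n. (\<mu> gchoose j) * (x / (1 + x)) ^ j * p j))"
  define D where "D = ball (0 :: complex) r \<inter> {z. - 1 < Re z}"
  have "summable (\<lambda>k. complex_of_real (c k * r ^ k))"
    using summ[OF \<open>1 \<le> r\<close>] by (subst summable_of_real_iff) (simp add: c_def)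
  then have radius: "ereal r \<le> fps_conv_radius C"
    using conv_radius_geI[of "fps_nth C" "of_real r"] \<open>1 \<le> r\<close>
    by (simp add: C_def fps_conv_radius_def)
  have eq: "eval_fps C z = binomial_closed_form \<mu> p n z" if "z \<in> D" for z
  proof (rule analytic_continuation_open[of "ball 0 1" D "eval_fps C" "binomial_closed_form \<mu> p n"])
    show "open D" unfolding D_def by (intro open_Int open_ball open_halfspace_Re_gt)
    show "connected D"
      unfolding D_def by (intro convex_connected convex_Int convex_ball convex_halfspace_Re_gt)
    show "ball 0 1 \<subseteq> D"
    proof
      fix w :: complex assume "w \<in> ball 0 1"
      then show "w \<in> D" using \<open>1 \<le> r\<close> abs_Re_le_cmod[of w] by (simp add: D_def)
    qed
    show "eval_fps C holomorphic_on D"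
      using radius ball_eball_mono[of r "fps_conv_radius C" "0 :: complex"]
      by (intro holomorphic_intros) (auto simp: D_def)
    have "1 + w \<notin> \<real>\<^sub>\<le>\<^sub>0" if "w \<in> D" for w
      using that by (auto simp: D_def complex_nonpos_Reals_iff)
    then show "binomial_closed_form \<mu> p n holomorphic_on D"
      unfolding binomial_closed_form_def by (intro holomorphic_intros) auto
    show "eval_fps C w = binomial_closed_form \<mu> p n w" if "w \<in> ball 0 1" for w
      using sums_binomial_closed_form[of w \<mu> p n] that
      by (simp add: sums_iff eval_fps_def C_def c_def)
  qed (use that in auto)
  have real_eq: "(\<Sum>k. c k * x ^ k) = E x" if "0 \<le> x" "x < r" for x
  proof -
    have "ereal (norm (complex_of_real x)) < fps_conv_radius C"
      using that radius by (intro less_le_trans[OF _ radius]) simp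
    from sums_eval_fps[OF this] have "(\<lambda>k. complex_of_real (c k * x ^ k)) sums of_real (E x)"
      using eq[of "of_real x"] binomial_closed_form_of_real[OF that(1), of \<mu> p n] that
      by (simp add: D_def C_def E_def)
    then show ?thesis by (simp only: sums_of_real_iff) (simp add: sums_iff)
  qed
  have sums: "(\<lambda>k. c k * r ^ k) sums (\<Sum>k. c k * r ^ k)"
    using summ[OF \<open>1 \<le> r\<close>] by (simp add: c_def summable_sums)
  then have "((\<lambda>x. \<Sum>k. c k * r ^ k * x ^ k) \<longlongrightarrow> (\<Sum>k. c k * r ^ k)) (at_left 1)"
    by (rule Abel_limit)
  moreover have "((\<lambda>x. E (r * x)) \<longlongrightarrow> E (r * 1)) (at_left 1)"
    unfolding E_def using \<open>1 \<le> r\<close> by (intro tendsto_intros) auto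
  moreover have "eventually (\<lambda>x::real. x \<in> {0<..<1}) (at_left 1)"
    by (rule eventually_at_left_real) simp
  then have "eventually (\<lambda>x. E (r * x) = (\<Sum>k. c k * r ^ k * x ^ k)) (at_left 1)"
  proof eventually_elim
    case (elim x)
    then have "0 \<le> r * x" "r * x < r * 1"
      using \<open>1 \<le> r\<close> by (simp, intro mult_strict_left_mono) auto
    then show ?case using real_eq[of "r * x"] by (simp add: power_mult_distrib mult.assoc)
  qed
  ultimately have "((\<lambda>x. \<Sum>k. c k * r ^ k * x ^ k) \<longlongrightarrow> (\<Sum>k. c k * r ^ k)) (at_left 1)"
    and "((\<lambda>x. \<Sum>k. c k * r ^ k * x ^ k) \<longlongrightarrow> E (r * 1)) (at_left 1)"
    by (simp_all add: Lim_transform_eventually)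
  then have "(\<Sum>k. c k * r ^ k) = E (r * 1)"
    by (rule tendsto_unique[rotated]) (rule trivial_limit_at_left_real)
  with sums show ?thesis by (simp add: c_def E_def)
qed

section \<open>Nabla sums and differences as multiplication of power series\<close>

text \<open>
  The power series \<open>(1 - X)\<^sup>-\<^sup>\<gamma>\<close>. Defined by composition, it inherits its law of exponents from that of
  the binomial series.
\<close>

definition nabla_kernel :: "real \<Rightarrow> real fps" where
  "nabla_kernel \<gamma> = fps_binomial (- \<gamma>) oo - fps_X"

lemma nabla_kernel_nth: "fps_nth (nabla_kernel \<gamma>) m = pochhammer \<gamma> m / fact m"
  by (simp add: nabla_kernel_def fps_compose_uminus' gbinomial_pochhammer
      flip: power_mult_distrib mult.assoc)

lemma nabla_kernel_add: "nabla_kernel (\<gamma> + \<delta>) = nabla_kernel \<gamma> * nabla_kernel \<delta>"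
  using fps_binomial_add_mult[of "- \<gamma>" "- \<delta>"]
  by (simp add: nabla_kernel_def fps_compose_mult_distrib)

lemma nabla_kernel_0 [simp]: "nabla_kernel 0 = 1"
  by (simp add: nabla_kernel_def)

lemma nabla_kernel_minus_1: "nabla_kernel (- 1) = 1 - fps_X"
  by (simp add: nabla_kernel_def fps_binomial_1 fps_compose_add_distrib)

lemma nabla_kernel_of_nat_mult: "nabla_kernel (real k * \<gamma>) = nabla_kernel \<gamma> ^ k"
  by (induction k) (simp_all add: ring_distribs nabla_kernel_add)

text \<open>
  The endpoint \<open>a\<close> is left out: no sum of positive order involves \<open>f a\<close>, whereas the sum of order zero
  returns it. Beyond \<open>a\<close> orders zero and positive obey the same law.
\<close>

definition grid_series :: "real \<Rightarrow> (real \<Rightarrow> real) \<Rightarrow> real fps" where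
  "grid_series a f = Abs_fps (\<lambda>i. f (a + 1 + real i))"

lemma rising_over_Gamma:
  assumes "0 < \<gamma>"
  shows "rising (real m + 1) (\<gamma> - 1) / Gamma \<gamma> = fps_nth (nabla_kernel \<gamma>) m"
proof -
  have "\<gamma> \<notin> \<int>\<^sub>\<le>\<^sub>0" using assms by (auto simp: nonpos_Ints_def)
  then have "Gamma (real m + \<gamma>) = pochhammer \<gamma> m * Gamma \<gamma>" "Gamma \<gamma> \<noteq> 0"
    by (auto simp: pochhammer_Gamma add.commute Gamma_eq_zero_iff)
  moreover have "Gamma (real m + 1) = fact m" by (simp add: Gamma_fact add.commute)
  ultimately show ?thesis by (simp add: rising_def nabla_kernel_nth)
qed

lemma grid_interval:
  "{s \<in> nats_from (a + 1). s \<le> a + 1 + real n} = (\<lambda>i. a + 1 + real i) ` {..n}"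
  by (auto simp: nats_from_def)

lemma nabla_sum_left_grid:
  assumes "0 \<le> \<gamma>"
  shows "nabla_sum_left a \<gamma> f (a + 1 + real n) = fps_nth (nabla_kernel \<gamma> * grid_series a f) n"
proof (cases "\<gamma> = 0")
  case True
  then show ?thesis by (simp add: nabla_sum_left_def grid_series_def)
next
  case False
  with assms have "0 < \<gamma>" by simp
  have "nabla_sum_left a \<gamma> f (a + 1 + real n) =
      (\<Sum>i\<le>n. rising (real n - real i + 1) (\<gamma> - 1) / Gamma \<gamma> * f (a + 1 + real i))"
    using False unfolding nabla_sum_left_def grid_interval
    by (subst sum.reindex) (auto simp: inj_on_def sum_distrib_left algebra_simps)
  also have "\<dots> = (\<Sum>i\<le>n. fps_nth (nabla_kernel \<gamma>) (n - i) * f (a + 1 + real i))"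
    using rising_over_Gamma[OF \<open>0 < \<gamma>\<close>] by (intro sum.cong) (auto simp flip: of_nat_diff)
  also have "\<dots> = fps_nth (nabla_kernel \<gamma> * grid_series a f) n"
    unfolding mult.commute[of "nabla_kernel \<gamma>"] fps_mult_nth
    by (simp add: grid_series_def atMost_atLeast0 mult.commute)
  finally show ?thesis .
qed

lemma nabla_sum_left_below:
  assumes "0 < \<gamma>" "t \<le> a"
  shows "nabla_sum_left a \<gamma> f t = 0"
proof -
  have "{s \<in> nats_from (a + 1). s \<le> t} = {}" using assms by (auto simp: nats_from_def)
  then show ?thesis using assms by (simp only: nabla_sum_left_def) simp
qed

text \<open>
  Each backward difference multiplies the series by \<open>1 - X\<close> and so lowers the order by one, provided
  that the function vanishes at the endpoint, whose value enters the difference at \<open>a + 1\<close>.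
\<close>

lemma backward_diff_iterate:
  assumes "\<And>t. t \<le> a \<Longrightarrow> g t = 0"
    and "\<And>n. g (a + 1 + real n) = fps_nth (nabla_kernel \<gamma> * \<Phi>) n"
  shows "t \<le> a \<Longrightarrow> (backward_diff ^^ j) g t = 0"
    and "(backward_diff ^^ j) g (a + 1 + real n) = fps_nth (nabla_kernel (\<gamma> - real j) * \<Phi>) n"
proof (induction j arbitrary: t n)
  case 0
  { case 1 then show ?case using assms by simp next
    case 2 then show ?case using assms by simp }
next
  case (Suc j)
  { case 1 then show ?case using Suc by (simp add: backward_diff_def)
  next
    case 2
    have step: "(backward_diff ^^ Suc j) g x = (backward_diff ^^ j) g x - (backward_diff ^^ j) g (x - 1)" for x
      by (simp add: backward_diff_def)
    have "nabla_kernel (\<gamma> - real (Suc j)) = (1 - fps_X) * nabla_kernel (\<gamma> - real j)"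
      using nabla_kernel_add[of "- 1" "\<gamma> - real j"] by (simp add: nabla_kernel_minus_1 diff_diff_eq add.commute)
    then have "nabla_kernel (\<gamma> - real (Suc j)) * \<Phi> = (1 - fps_X) * (nabla_kernel (\<gamma> - real j) * \<Phi>)"
      by (simp only: mult.assoc)
    moreover have "(backward_diff ^^ j) g (a + 1 + real n - 1) =
        (if n = 0 then 0 else fps_nth (nabla_kernel (\<gamma> - real j) * \<Phi>) (n - 1))"
      using Suc.IH(1)[of a] Suc.IH(2)[of "n - 1"] by (cases n) (simp_all add: algebra_simps)
    ultimately show ?case
      unfolding step using Suc.IH(2)[of n] by (simp add: left_diff_distrib) }
qed

lemma nabla_diff_left_grid:
  assumes "0 < \<mu>"
  shows "t \<le> a \<Longrightarrow> nabla_diff_left a \<mu> f t = 0"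
    and "nabla_diff_left a \<mu> f (a + 1 + real n) = fps_nth (nabla_kernel (- \<mu>) * grid_series a f) n"
proof -
  define j where "j = nat \<lfloor>\<mu>\<rfloor> + 1"
  \<comment> \<open>The inner sum has positive order, hence vanishes up to \<open>a\<close>, as iterating differences requires.\<close>
  have "0 < real j - \<mu>" using assms unfolding j_def by linarith
  note iter = backward_diff_iterate[of a "nabla_sum_left a (real j - \<mu>) f" "real j - \<mu>"
      "grid_series a f", OF nabla_sum_left_below[OF this] nabla_sum_left_grid[OF less_imp_le[OF this]]]
  show "t \<le> a \<Longrightarrow> nabla_diff_left a \<mu> f t = 0"
    using iter(1)[of t j] by (simp add: nabla_diff_left_def Let_def j_def)
  show "nabla_diff_left a \<mu> f (a + 1 + real n) = fps_nth (nabla_kernel (- \<mu>) * grid_series a f) n"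
    using iter(2)[of j n] by (simp add: nabla_diff_left_def Let_def j_def)
qed

section \<open>The kernel of the iterated operators\<close>

lemma fps_nth_compose_mult:
  fixes g h w :: "'a :: comm_ring_1 fps"
  assumes "fps_nth g 0 = 0"
  shows "fps_nth ((w oo g) * h) n = (\<Sum>j\<le>n. fps_nth w j * fps_nth (g ^ j * h) n)"
proof -
  have "fps_nth (w oo g) i = (\<Sum>j\<le>n. fps_nth w j * fps_nth (g ^ j) i)" if "i \<le> n" for i
    unfolding fps_compose_nth
    using that by (intro sum.mono_neutral_left)
      (auto simp: startsby_zero_power_prefix[OF assms, rule_format])
  then have "fps_nth ((w oo g) * h) n =
      (\<Sum>i\<le>n. \<Sum>j\<le>n. fps_nth w j * fps_nth (g ^ j) i * fps_nth h (n - i))"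
    by (simp add: fps_mult_nth sum_distrib_right atMost_atLeast0)
  also have "\<dots> = (\<Sum>j\<le>n. fps_nth w j * fps_nth (g ^ j * h) n)"
    by (subst sum.swap) (simp add: fps_mult_nth sum_distrib_left atMost_atLeast0 mult.assoc)
  finally show ?thesis .
qed

text \<open>
  As a function of \<open>k\<close> the coefficient is a polynomial of degree at most \<open>n\<close>: this is what makes the
  defining series of the operators binomial series weighted by a polynomial.
\<close>

lemma nabla_kernel_power_nth:
  "fps_nth (nabla_kernel \<gamma> ^ k * \<Phi>) n =
     (\<Sum>j\<le>n. real (k choose j) * fps_nth ((nabla_kernel \<gamma> - 1) ^ j * \<Phi>) n)"
proof -
  have "fps_binomial (real k) oo (nabla_kernel \<gamma> - 1) = (1 + (nabla_kernel \<gamma> - 1)) ^ k"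
    by (simp add: fps_binomial_of_nat fps_compose_add_distrib nabla_kernel_nth flip: fps_compose_power)
  then have "nabla_kernel \<gamma> ^ k = fps_binomial (real k) oo (nabla_kernel \<gamma> - 1)"
    by simp
  then show ?thesis
    by (simp add: fps_nth_compose_mult nabla_kernel_nth binomial_gbinomial)
qed

text \<open>
  The composition is \<open>(1 + \<alpha> N)\<^sup>\<mu>\<close> with \<open>N = (1 - X)\<^sup>-\<^sup>\<alpha> - 1\<close>. If \<open>B(1) = 1\<close>, it would give
  \<open>(1 - X)\<^sup>-\<^sup>\<mu>\<close> for \<open>\<alpha> = 1\<close> too; the case distinction mirrors the convention for the operators.
\<close>

definition AB_kernel :: "(real \<Rightarrow> real) \<Rightarrow> real \<Rightarrow> real \<Rightarrow> real fps" where
  "AB_kernel B \<alpha> \<mu> =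
     (if \<alpha> = 1 then nabla_kernel \<mu>
      else fps_const (B \<alpha> powr - \<mu>) * (fps_binomial \<mu> oo (fps_const \<alpha> * (nabla_kernel \<alpha> - 1))))"

lemma AB_kernel_add: "AB_kernel B \<alpha> (\<mu> + \<nu>) = AB_kernel B \<alpha> \<mu> * AB_kernel B \<alpha> \<nu>"
proof (cases "\<alpha> = 1")
  case True
  then show ?thesis by (simp add: AB_kernel_def nabla_kernel_add)
next
  case False
  have "fps_const (B \<alpha> powr - (\<mu> + \<nu>)) = fps_const (B \<alpha> powr - \<mu>) * fps_const (B \<alpha> powr - \<nu>)"
    by (simp add: powr_add[symmetric])
  with False show ?thesis
    by (simp add: AB_kernel_def fps_binomial_add_mult fps_compose_mult_distrib nabla_kernel_nth
        mult_ac del: fps_const_mult)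
qed

lemma AB_kernel_mult_nth:
  assumes "\<alpha> \<noteq> 1"
  shows "fps_nth (AB_kernel B \<alpha> \<mu> * \<Phi>) n = B \<alpha> powr - \<mu> *
     (\<Sum>j\<le>n. (\<mu> gchoose j) * \<alpha> ^ j * fps_nth ((nabla_kernel \<alpha> - 1) ^ j * \<Phi>) n)"
  using assms
  by (simp add: AB_kernel_def fps_nth_compose_mult nabla_kernel_nth power_mult_distrib mult.assoc)

lemma AB_coeff_eq:
  assumes "\<alpha> < 1" "0 < B \<alpha>"
  shows "AB_coeff B \<alpha> \<mu> k =
     ((1 - \<alpha>) / B \<alpha>) powr \<mu> * ((\<mu> gchoose k) * (\<alpha> / (1 - \<alpha>)) ^ k)"
  using assms
  by (simp add: AB_coeff_def powr_diff powr_realpow powr_divide power_divide mult_ac)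

text \<open>
  With \<open>r = \<alpha> / (1 - \<alpha>)\<close> one has \<open>r / (1 + r) = \<alpha>\<close> and \<open>1 + r = 1 / (1 - \<alpha>)\<close>. Hence the closed form of the
  series, which is an expansion in powers of \<open>r / (1 + r)\<close>, is the one that defines the kernel, and the
  factors \<open>(1 - \<alpha>)\<^sup>\<mu>\<close> and \<open>(1 + r)\<^sup>\<mu>\<close> cancel.
\<close>

lemma AB_left_grid:
  assumes "0 \<le> \<alpha>" "\<alpha> \<le> 1" "0 < B \<alpha>"
    and conv: "1 / 2 \<le> \<alpha> \<Longrightarrow> \<alpha> < 1 \<Longrightarrow> AB_left_converges B a \<alpha> \<mu> f (a + 1 + real n)"
  shows "AB_left B a \<alpha> \<mu> f (a + 1 + real n) = fps_nth (AB_kernel B \<alpha> \<mu> * grid_series a f) n"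
proof (cases "\<alpha> = 1")
  case True
  consider "0 < \<mu>" | "\<mu> = 0" | "\<mu> < 0" by linarith
  then show ?thesis
  proof cases
    case 1
    then show ?thesis using True nabla_sum_left_grid[of \<mu> a f n] by (simp add: AB_left_def AB_kernel_def)
  next
    case 2
    then show ?thesis using True by (simp add: AB_left_def AB_kernel_def grid_series_def)
  next
    case 3
    then show ?thesis using True nabla_diff_left_grid(2)[of "- \<mu>" a f n] by (simp add: AB_left_def AB_kernel_def)
  qed
next
  case False
  with assms have "\<alpha> < 1" by simp
  define r where "r = \<alpha> / (1 - \<alpha>)"
  define \<kappa> where "\<kappa> = ((1 - \<alpha>) / B \<alpha>) powr \<mu>"
  define p where "p j = fps_nth ((nabla_kernel \<alpha> - 1) ^ j * grid_series a f) n" for j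
  define c where "c k = (\<mu> gchoose k) * binomial_transform p n k * r ^ k" for k
  have r: "0 \<le> r" "1 \<le> r \<longleftrightarrow> 1 / 2 \<le> \<alpha>" "r / (1 + r) = \<alpha>" "1 + r = 1 / (1 - \<alpha>)"
    using \<open>\<alpha> < 1\<close> assms(1) by (auto simp: r_def field_simps)
  have "\<kappa> \<noteq> 0" using \<open>\<alpha> < 1\<close> assms by (simp add: \<kappa>_def)
  have "nabla_sum_left a (real k * \<alpha>) f (a + 1 + real n) = binomial_transform p n k" for k
    using assms(1)
    by (simp add: nabla_sum_left_grid nabla_kernel_of_nat_mult nabla_kernel_power_nth
        binomial_transform_def p_def)
  then have terms: "(\<lambda>k. AB_coeff B \<alpha> \<mu> k * nabla_sum_left a (real k * \<alpha>) f (a + 1 + real n)) =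
      (\<lambda>k. \<kappa> * c k)"
    using \<open>\<alpha> < 1\<close> assms(3) by (simp add: fun_eq_iff AB_coeff_eq \<kappa>_def c_def r_def)
  have "summable c" if "1 \<le> r"
    using conv that \<open>\<alpha> < 1\<close> \<open>\<kappa> \<noteq> 0\<close> r(2) by (simp add: AB_left_converges_def terms summable_cmult_iff)
  then have "c sums ((1 + r) powr \<mu> * (\<Sum>j\<le>n. (\<mu> gchoose j) * (r / (1 + r)) ^ j * p j))"
    unfolding c_def using r(1) by (intro sums_binomial_transform) auto
  then have "AB_left B a \<alpha> \<mu> f (a + 1 + real n) =
      \<kappa> * ((1 + r) powr \<mu> * (\<Sum>j\<le>n. (\<mu> gchoose j) * \<alpha> ^ j * p j))"
    unfolding r(3) using \<open>\<alpha> < 1\<close> by (simp add: AB_left_def terms suminf_mult sums_iff)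
  moreover have "\<kappa> * (1 + r) powr \<mu> = B \<alpha> powr - \<mu>"
    using \<open>\<alpha> < 1\<close> assms(3) by (simp add: \<kappa>_def r(4) powr_minus powr_divide field_simps)
  ultimately show ?thesis
    using False by (simp add: AB_kernel_mult_nth p_def flip: mult.assoc)
qed

section \<open>The semigroup property\<close>

text \<open>
  At the endpoint only the summand with \<open>k = 0\<close> survives. For \<open>\<alpha> = 1\<close> sums of positive order and
  differences annihilate the value at \<open>a\<close>, while order zero retains it; hence the exception
  \<open>\<mu> + \<nu> = 0\<close>, \<open>\<mu> \<noteq> 0\<close> to the semigroup property at this point.
\<close>

definition AB_endpoint_factor :: "(real \<Rightarrow> real) \<Rightarrow> real \<Rightarrow> real \<Rightarrow> real" where
  "AB_endpoint_factor B \<alpha> \<mu> =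
     (if \<alpha> = 1 then (if \<mu> = 0 then 1 else 0) else ((1 - \<alpha>) / B \<alpha>) powr \<mu>)"

lemma AB_left_endpoint:
  assumes "0 \<le> \<alpha>" "\<alpha> \<le> 1" "0 < B \<alpha>"
  shows "AB_left B a \<alpha> \<mu> f a = AB_endpoint_factor B \<alpha> \<mu> * f a"
proof (cases "\<alpha> = 1")
  case True
  then show ?thesis
    using nabla_sum_left_below[of \<mu> a a f] nabla_diff_left_grid(1)[of "- \<mu>" a a f]
    by (auto simp: AB_left_def AB_endpoint_factor_def)
next
  case False
  with assms have "\<alpha> < 1" by simp
  have "AB_coeff B \<alpha> \<mu> k * nabla_sum_left a (real k * \<alpha>) f a =
      (if k = 0 then AB_endpoint_factor B \<alpha> \<mu> * f a else 0)" for k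
    using \<open>\<alpha> < 1\<close> assms nabla_sum_left_below[of "real k * \<alpha>" a a f]
    by (cases "\<alpha> = 0")
      (auto simp: AB_coeff_eq AB_endpoint_factor_def nabla_sum_left_def[of _ 0])
  then show ?thesis
    using \<open>\<alpha> < 1\<close> sums_single[of 0 "\<lambda>_. AB_endpoint_factor B \<alpha> \<mu> * f a"]
    by (simp add: AB_left_def sums_iff)
qed

text \<open>
  The value at \<open>a + 1 + n\<close> of the outer operator depends on the inner function only through the
  coefficients up to \<open>n\<close> of its series. This is why convergence of the inner operator is assumed up to \<open>t\<close>.
\<close>

lemma AB_left_semigroup:
  assumes \<alpha>: "0 \<le> \<alpha>" "\<alpha> \<le> 1" and B: "0 < B \<alpha>" and t: "t \<in> nats_from a"
    and conv: "1 / 2 \<le> \<alpha> \<and> \<alpha> < 1 \<longrightarrow>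
           (\<forall>s \<in> nats_from a. s \<le> t \<longrightarrow> AB_left_converges B a \<alpha> \<nu> f s) \<and>
           AB_left_converges B a \<alpha> \<mu> (AB_left B a \<alpha> \<nu> f) t \<and>
           AB_left_converges B a \<alpha> (\<mu> + \<nu>) f t"
    and nondeg: "\<not> (\<alpha> = 1 \<and> \<mu> \<noteq> 0 \<and> \<mu> + \<nu> = 0 \<and> t = a)"
  shows "AB_left B a \<alpha> \<mu> (AB_left B a \<alpha> \<nu> f) t = AB_left B a \<alpha> (\<mu> + \<nu>) f t"
proof -
  from t obtain m where m: "t = a + real m" by (auto simp: nats_from_def)
  show ?thesis
  proof (cases m)
    case 0
    then have "t = a" by (simp add: m)
    with nondeg have "AB_endpoint_factor B \<alpha> \<mu> * AB_endpoint_factor B \<alpha> \<nu> =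
        AB_endpoint_factor B \<alpha> (\<mu> + \<nu>)"
      by (auto simp: AB_endpoint_factor_def powr_add)
    then show ?thesis
      unfolding \<open>t = a\<close> AB_left_endpoint[where B = B, OF \<alpha> B] by (simp flip: mult.assoc)
  next
    case (Suc n)
    then have tn: "t = a + 1 + real n" by (simp add: m)
    have inner: "fps_nth (grid_series a (AB_left B a \<alpha> \<nu> f)) i =
        fps_nth (AB_kernel B \<alpha> \<nu> * grid_series a f) i" if "i \<le> n" for i
    proof -
      have "a + 1 + real i \<in> nats_from a"
        unfolding nats_from_def by (auto intro: exI[of _ "Suc i"])
      then show ?thesis
        using conv that tn by (subst AB_left_grid[where B = B, OF \<alpha> B, symmetric]) (auto simp: grid_series_def)
    qed
    have "AB_left B a \<alpha> \<mu> (AB_left B a \<alpha> \<nu> f) t =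
        fps_nth (AB_kernel B \<alpha> \<mu> * grid_series a (AB_left B a \<alpha> \<nu> f)) n"
      unfolding tn using conv tn by (intro AB_left_grid[where B = B, OF \<alpha> B]) auto
    also have "\<dots> = fps_nth (AB_kernel B \<alpha> \<mu> * (AB_kernel B \<alpha> \<nu> * grid_series a f)) n"
      unfolding fps_mult_nth[of "AB_kernel B \<alpha> \<mu>"] by (intro sum.cong) (auto simp: inner)
    also have "\<dots> = fps_nth (AB_kernel B \<alpha> (\<mu> + \<nu>) * grid_series a f) n"
      by (simp add: AB_kernel_add mult.assoc)
    also have "\<dots> = AB_left B a \<alpha> (\<mu> + \<nu>) f t"
      unfolding tn using conv tn by (intro AB_left_grid[where B = B, OF \<alpha> B, symmetric]) auto
    finally show ?thesis .
  qed
qed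

section \<open>Reflection\<close>

lemma nats_to_reflect: "t \<in> nats_to b \<longleftrightarrow> - t \<in> nats_from (- b)"
proof -
  have "t = b - real n \<longleftrightarrow> - t = - b + real n" for n by auto
  then show ?thesis by (simp add: nats_to_def nats_from_def)
qed

lemma nabla_sum_right_reflect:
  "nabla_sum_right b \<gamma> f t = nabla_sum_left (- b) \<gamma> (\<lambda>s. f (- s)) (- t)"
proof -
  have "{s \<in> nats_to (b - 1). t \<le> s} = uminus ` {s \<in> nats_from (- b + 1). s \<le> - t}"
  proof (intro equalityI subsetI)
    fix s assume "s \<in> {s \<in> nats_to (b - 1). t \<le> s}"
    then have "- s \<in> {s \<in> nats_from (- b + 1). s \<le> - t}" by (simp add: nats_to_reflect)
    then show "s \<in> uminus ` {s \<in> nats_from (- b + 1). s \<le> - t}" by (rule rev_image_eqI) simp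
  qed (auto simp: nats_to_reflect)
  then show ?thesis
    by (simp add: nabla_sum_right_def nabla_sum_left_def sum.reindex algebra_simps)
qed

lemma nabla_diff_right_reflect:
  "nabla_diff_right b \<mu> f t = nabla_diff_left (- b) \<mu> (\<lambda>s. f (- s)) (- t)"
proof -
  have "((\<lambda>g t. - forward_diff g t) ^^ n) (\<lambda>t. g (- t)) t = (backward_diff ^^ n) g (- t)" for n g t
  proof (induction n arbitrary: t)
    case (Suc n)
    then show ?case by (simp add: forward_diff_def backward_diff_def)
  qed simp
  moreover have "nabla_sum_right b \<gamma> f = (\<lambda>t. nabla_sum_left (- b) \<gamma> (\<lambda>s. f (- s)) (- t))" for \<gamma>
    by (rule ext) (rule nabla_sum_right_reflect)
  ultimately show ?thesis
    by (simp only: nabla_diff_right_def nabla_diff_left_def Let_def)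
qed

lemma AB_right_reflect: "AB_right B b \<alpha> \<mu> f t = AB_left B (- b) \<alpha> \<mu> (\<lambda>s. f (- s)) (- t)"
  by (simp add: AB_right_def AB_left_def nabla_sum_right_reflect nabla_diff_right_reflect)

lemma AB_right_converges_reflect:
  "AB_right_converges B b \<alpha> \<mu> f t \<longleftrightarrow> AB_left_converges B (- b) \<alpha> \<mu> (\<lambda>s. f (- s)) (- t)"
  by (simp add: AB_right_converges_def AB_left_converges_def nabla_sum_right_reflect)

lemma AB_right_semigroup:
  assumes "0 \<le> \<alpha>" "\<alpha> \<le> 1" and "0 < B \<alpha>" and "t \<in> nats_to b"
    and conv: "1 / 2 \<le> \<alpha> \<and> \<alpha> < 1 \<longrightarrow>
           (\<forall>s \<in> nats_to b. t \<le> s \<longrightarrow> AB_right_converges B b \<alpha> \<nu> f s) \<and>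
           AB_right_converges B b \<alpha> \<mu> (AB_right B b \<alpha> \<nu> f) t \<and>
           AB_right_converges B b \<alpha> (\<mu> + \<nu>) f t"
    and "\<not> (\<alpha> = 1 \<and> \<mu> \<noteq> 0 \<and> \<mu> + \<nu> = 0 \<and> t = b)"
  shows "AB_right B b \<alpha> \<mu> (AB_right B b \<alpha> \<nu> f) t = AB_right B b \<alpha> (\<mu> + \<nu>) f t"
proof -
  let ?f = "\<lambda>s. f (- s)"
  have inner: "(\<lambda>s. AB_right B b \<alpha> \<nu> f (- s)) = AB_left B (- b) \<alpha> \<nu> ?f"
    by (simp add: AB_right_reflect fun_eq_iff)
  have "AB_left_converges B (- b) \<alpha> \<nu> ?f s"
    if "1 / 2 \<le> \<alpha> \<and> \<alpha> < 1" "s \<in> nats_from (- b)" "s \<le> - t" for s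
    using conv that nats_to_reflect[of "- s" b]
    by (auto simp: AB_right_converges_reflect dest!: bspec[where x = "- s"])
  then have "AB_left B (- b) \<alpha> \<mu> (AB_left B (- b) \<alpha> \<nu> ?f) (- t) = AB_left B (- b) \<alpha> (\<mu> + \<nu>) ?f (- t)"
    using assms by (intro AB_left_semigroup)
      (auto simp: AB_right_converges_reflect inner nats_to_reflect)
  then show ?thesis by (simp add: AB_right_reflect inner)
qed

theorem theorem2p3:
  fixes a b \<alpha> \<mu> \<nu> :: real and B :: "real \<Rightarrow> real"
  assumes "0 \<le> \<alpha>" and "\<alpha> \<le> 1"
    and "\<And>x. 0 \<le> x \<Longrightarrow> x \<le> 1 \<Longrightarrow> B x > 0" and "B 0 = 1" and "B 1 = 1"
  shows
    "(\<forall>f :: real \<Rightarrow> real. \<forall>t \<in> nats_from a.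
        (1/2 \<le> \<alpha> \<and> \<alpha> < 1 \<longrightarrow>
           (\<forall>s \<in> nats_from a. s \<le> t \<longrightarrow> AB_left_converges B a \<alpha> \<nu> f s) \<and>
           AB_left_converges B a \<alpha> \<mu> (AB_left B a \<alpha> \<nu> f) t \<and>
           AB_left_converges B a \<alpha> (\<mu> + \<nu>) f t) \<longrightarrow>
        \<not> (\<alpha> = 1 \<and> \<mu> \<noteq> 0 \<and> \<mu> + \<nu> = 0 \<and> t = a) \<longrightarrow>
        AB_left B a \<alpha> \<mu> (AB_left B a \<alpha> \<nu> f) t = AB_left B a \<alpha> (\<mu> + \<nu>) f t) \<and>
     (\<forall>f :: real \<Rightarrow> real. \<forall>t \<in> nats_to b.
        (1/2 \<le> \<alpha> \<and> \<alpha> < 1 \<longrightarrow>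
           (\<forall>s \<in> nats_to b. t \<le> s \<longrightarrow> AB_right_converges B b \<alpha> \<nu> f s) \<and>
           AB_right_converges B b \<alpha> \<mu> (AB_right B b \<alpha> \<nu> f) t \<and>
           AB_right_converges B b \<alpha> (\<mu> + \<nu>) f t) \<longrightarrow>
        \<not> (\<alpha> = 1 \<and> \<mu> \<noteq> 0 \<and> \<mu> + \<nu> = 0 \<and> t = b) \<longrightarrow>
        AB_right B b \<alpha> \<mu> (AB_right B b \<alpha> \<nu> f) t = AB_right B b \<alpha> (\<mu> + \<nu>) f t)"
proof (intro conjI allI ballI impI, goal_cases)
  case (1 f t)
  show ?case using assms(1,2) assms(3)[OF assms(1,2)] 1 by (rule AB_left_semigroup)
next
  case (2 f t)
  show ?case using assms(1,2) assms(3)[OF assms(1,2)] 2 by (rule AB_right_semigroup)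
qed

end
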